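(* Let $m,n\ge 1$ be integers and let $A=[A_{i,j}]_{i,j=1}^m\in \mathbb{M}_m(\mathbb{M}_n)$ be positive semidefinite. Then \[ (\mathrm{tr}_2 A^{\tau})\otimes I_n\ \ge\ -A^{\tau}+2A^{\tau}\circ J, \] where $J\in\mathbb{M}_m(\mathbb{M}_n)$ is the $m\times m$ block matrix with each block equal to $I_n$.
   Context: $\mathbb{M}_n$ is the space of $n\times n$ complex matrices. $\mathbb{M}_m(\mathbb{M}_n)$ is the set of $m\times m$ block matrices $A=[A_{i,j}]_{i,j=1}^m$ with blocks $A_{i,j}\in\mathbb{M}_n$, regarded also as $mn\times mn$ complex matrices. For Hermitian $X,Y$ of the same size, $X\ge Y$ means $X-Y$ is positive semidefinite. The partial transpose of $A$ is $A^{\tau}=[A_{j,i}]_{i,j=1}^m$ (the $(i,j)$ block of $A^\tau$ is $A_{j,i}$; the blocks themselves are not transposed). The second partial trace is $\mathrm{tr}_2 A=[\mathrm{tr}\,A_{i,j}]_{i,j=1}^m\in\mathbb{M}_m$, where $\mathrm{tr}$ is the usual trace; $\mathrm{tr}_2 A^\tau$ means $\mathrm{tr}_2(A^\tau)$. $\otimes$ is the Kronecker product: for $X=[x_{i,j}]\in\mathbb{M}_m$ and $Y\in\mathbb{M}_n$, $X\otimes Y\in\mathbb{M}_m(\mathbb{M}_n)$ has $(i,j)$ block $x_{i,j}Y$. $\circ$ is the Hadamard (entrywise) product of $mn\times mn$ matrices. *)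

theory Defs
  imports "HOL-Analysis.Analysis"
begin

text \<open>
  An \<open>m \<times> m\<close> block matrix with \<open>n \<times> n\<close> blocks is a matrix indexed by pairs: row \<open>(i, k)\<close> is
  row \<open>k\<close> inside block row \<open>i\<close>, so the \<open>mn \<times> mn\<close> matrix and its block structure are the same
  object.  The sizes are \<open>m = CARD('m)\<close> and \<open>n = CARD('n)\<close>, which are at least 1 because types
  are nonempty.
\<close>

type_synonym ('m, 'n) block_matrix = "complex ^ ('m \<times> 'n) ^ ('m \<times> 'n)"

definition block ::
  "('m::finite, 'n::finite) block_matrix \<Rightarrow> 'm \<Rightarrow> 'm \<Rightarrow> complex ^ 'n ^ 'n" where
  "block A i j = (\<chi> k l. A $ (i, k) $ (j, l))"

definition of_blocks ::
  "('m \<Rightarrow> 'm \<Rightarrow> complex ^ 'n ^ 'n) \<Rightarrow> ('m::finite, 'n::finite) block_matrix" where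
  "of_blocks B = (\<chi> p q. B (fst p) (fst q) $ snd p $ snd q)"

definition partial_transpose ::
  "('m::finite, 'n::finite) block_matrix \<Rightarrow> ('m, 'n) block_matrix" where
  "partial_transpose A = of_blocks (\<lambda>i j. block A j i)"

definition partial_trace2 ::
  "('m::finite, 'n::finite) block_matrix \<Rightarrow> complex ^ 'm ^ 'm" where
  "partial_trace2 A = (\<chi> i j. trace (block A i j))"

definition kronecker ::
  "complex ^ 'm ^ 'm \<Rightarrow> complex ^ 'n ^ 'n \<Rightarrow> ('m::finite, 'n::finite) block_matrix" where
  "kronecker X Y = of_blocks (\<lambda>i j. \<chi> k l. X $ i $ j * Y $ k $ l)"

definition hadamard ::
  "complex ^ 'd ^ 'd \<Rightarrow> complex ^ 'd ^ 'd \<Rightarrow> complex ^ 'd ^ 'd::finite" where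
  "hadamard A B = (\<chi> p q. A $ p $ q * B $ p $ q)"

definition hermitian :: "complex ^ 'd ^ 'd::finite \<Rightarrow> bool" where
  "hermitian A \<longleftrightarrow> (\<forall>p q. A $ p $ q = cnj (A $ q $ p))"

text \<open>
  The quadratic form of a Hermitian matrix is real, so comparing its real part with 0 loses
  nothing.
\<close>

definition psd :: "complex ^ 'd ^ 'd::finite \<Rightarrow> bool" where
  "psd A \<longleftrightarrow> hermitian A \<and>
    (\<forall>x :: complex ^ 'd. 0 \<le> Re (\<Sum>p\<in>UNIV. cnj (x $ p) * (A *v x) $ p))"

text \<open>The Loewner order, which relates Hermitian matrices only.\<close>

definition loewner_ge :: "complex ^ 'd ^ 'd::finite \<Rightarrow> complex ^ 'd ^ 'd \<Rightarrow> bool"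
    (infix "\<succeq>" 50) where
  "X \<succeq> Y \<longleftrightarrow> hermitian X \<and> hermitian Y \<and> psd (X - Y)"

end

theory Submission
  imports Defs
begin

text \<open>
  Write \<open>a(i,s;j,t)\<close> for the entries of \<open>A\<close>.  In the difference of the two sides, the entry at
  \<open>(i,k), (j,l)\<close> is \<open>a(j,k;i,l)\<close> when \<open>k \<noteq> l\<close>, and the sum of \<open>a(j,s;i,s)\<close> over \<open>s \<noteq> k\<close> when
  \<open>k = l\<close>: the Hadamard term subtracts the diagonal contribution of \<open>A\<^sup>\<tau>\<close> twice, once to cancel it and
  once to remove the term \<open>s = k\<close> from the partial trace.

  The partial transpose disappears when a vector \<open>x\<close> is split into its slices
  \<open>x\<^sub>k = (x(i,k))\<^sub>i\<close>, which are conjugated and moved to other slots.  Let \<open>u\<^sub>k\<^sub>l\<close> be the vector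
  that carries the conjugate of \<open>x\<^sub>l\<close> in slot \<open>k\<close> and vanishes elsewhere.  In the quadratic form of
  the difference at \<open>x\<close>, the diagonal entries contribute the sum of \<open>\<langle>u\<^sub>l\<^sub>k, A u\<^sub>l\<^sub>k\<rangle>\<close> over \<open>l \<noteq> k\<close>, and
  the others the sum of \<open>\<langle>u\<^sub>k\<^sub>l, A u\<^sub>l\<^sub>k\<rangle>\<close> over \<open>k \<noteq> l\<close>.
  Pairing \<open>(k,l)\<close> with \<open>(l,k)\<close> completes the square: twice the form is the sum over \<open>k \<noteq> l\<close> of
  \<open>\<langle>u\<^sub>k\<^sub>l + u\<^sub>l\<^sub>k, A (u\<^sub>k\<^sub>l + u\<^sub>l\<^sub>k)\<rangle>\<close>, and every summand is nonnegative because \<open>A\<close> is positive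
  semidefinite.
\<close>

definition sesq_form :: "complex ^ 'd ^ 'd::finite \<Rightarrow> complex ^ 'd \<Rightarrow> complex ^ 'd \<Rightarrow> complex" where
  "sesq_form A u v = (\<Sum>p\<in>UNIV. \<Sum>q\<in>UNIV. cnj (u $ p) * A $ p $ q * v $ q)"

lemma psd_iff_sesq_form:
  "psd A \<longleftrightarrow> hermitian A \<and> (\<forall>x. 0 \<le> Re (sesq_form A x x))"
  by (simp add: psd_def sesq_form_def matrix_vector_mult_def sum_distrib_left mult.assoc)

lemma sesq_form_add_left: "sesq_form A (u + v) w = sesq_form A u w + sesq_form A v w"
  by (simp add: sesq_form_def algebra_simps sum.distrib)

lemma sesq_form_add_right: "sesq_form A w (u + v) = sesq_form A w u + sesq_form A w v"
  by (simp add: sesq_form_def algebra_simps sum.distrib)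

lemma sum_UNIV_prod:
  "(\<Sum>p\<in>(UNIV :: ('a::finite \<times> 'b::finite) set). f p) = (\<Sum>i\<in>UNIV. \<Sum>k\<in>UNIV. f (i, k))"
  by (simp add: sum.cartesian_product flip: UNIV_Times_UNIV)

text \<open>The tensor product of \<open>f\<close> with the \<open>k\<close>-th unit vector.\<close>

definition slot :: "'n::finite \<Rightarrow> ('m::finite \<Rightarrow> complex) \<Rightarrow> complex ^ ('m \<times> 'n)" where
  "slot k f = (\<chi> p. if snd p = k then f (fst p) else 0)"

lemma sesq_form_slot:
  "sesq_form A (slot k f) (slot l g) =
    (\<Sum>i\<in>UNIV. \<Sum>j\<in>UNIV. cnj (f i) * A $ (i, k) $ (j, l) * g j)"
proof -
  have col: "(\<Sum>q\<in>UNIV. c * A $ p $ q * slot l g $ q) = (\<Sum>j\<in>UNIV. c * A $ p $ (j, l) * g j)"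
    for c p
    by (simp add: sum_UNIV_prod slot_def if_distrib[of "\<lambda>z. _ * z"] cong: if_cong)
  have row: "(\<Sum>k'\<in>UNIV. \<Sum>j\<in>UNIV. cnj (slot k f $ (i, k')) * A $ (i, k') $ (j, l) * g j) =
      (\<Sum>j\<in>UNIV. cnj (f i) * A $ (i, k) $ (j, l) * g j)" for i
    by (subst sum.swap)
       (simp add: slot_def if_distrib[of cnj] if_distrib[of "\<lambda>z. z * _"] cong: if_cong)
  show ?thesis
    unfolding sesq_form_def col by (simp add: sum_UNIV_prod row)
qed

lemma sesq_form_by_slots:
  fixes x :: "complex ^ ('m::finite \<times> 'n::finite)"
  shows "sesq_form M x x = (\<Sum>k\<in>UNIV. \<Sum>l\<in>UNIV. \<Sum>i\<in>UNIV. \<Sum>j\<in>UNIV.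
    cnj (x $ (i, k)) * M $ (i, k) $ (j, l) * x $ (j, l))"
proof -
  have "sesq_form M x x = (\<Sum>i\<in>UNIV. \<Sum>k\<in>UNIV. \<Sum>l\<in>UNIV. \<Sum>j\<in>UNIV.
      cnj (x $ (i, k)) * M $ (i, k) $ (j, l) * x $ (j, l))"
    unfolding sesq_form_def sum_UNIV_prod by (intro sum.cong refl sum.swap)
  also have "\<dots> = (\<Sum>k\<in>UNIV. \<Sum>i\<in>UNIV. \<Sum>l\<in>UNIV. \<Sum>j\<in>UNIV.
      cnj (x $ (i, k)) * M $ (i, k) $ (j, l) * x $ (j, l))"
    by (rule sum.swap)
  also have "\<dots> = (\<Sum>k\<in>UNIV. \<Sum>l\<in>UNIV. \<Sum>i\<in>UNIV. \<Sum>j\<in>UNIV.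
      cnj (x $ (i, k)) * M $ (i, k) $ (j, l) * x $ (j, l))"
    by (intro sum.cong refl sum.swap)
  finally show ?thesis .
qed

text \<open>
  Swapping \<open>k\<close> and \<open>l\<close> permutes the pairs \<open>k \<noteq> l\<close>, so the double sum of the form below is
  unchanged by it; adding both versions makes each summand a complete square.
\<close>

lemma sum_sesq_form_symmetrized_nonneg:
  fixes u :: "'n::finite \<Rightarrow> 'n \<Rightarrow> complex ^ 'd::finite"
  assumes "psd A"
  shows "0 \<le> Re (\<Sum>k\<in>UNIV. \<Sum>l\<in>UNIV - {k}.
    sesq_form A (u l k) (u l k) + sesq_form A (u k l) (u l k))"
    (is "0 \<le> Re ?S")
proof -
  let ?h = "\<lambda>k l. sesq_form A (u l k) (u l k) + sesq_form A (u k l) (u l k)"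
  have swap: "?S = (\<Sum>k\<in>UNIV. \<Sum>l\<in>UNIV - {k}. ?h l k)"
  proof -
    have off: "UNIV - {k} = {l\<in>UNIV. l \<noteq> k}" for k :: 'n
      by auto
    show ?thesis
      unfolding off by (subst sum.swap_restrict) (auto intro!: sum.cong)
  qed
  have square: "?h k l + ?h l k = sesq_form A (u k l + u l k) (u k l + u l k)" for k l
    by (simp add: sesq_form_add_left sesq_form_add_right)
  have "?S + ?S = (\<Sum>k\<in>UNIV. \<Sum>l\<in>UNIV - {k}. ?h k l + ?h l k)"
    by (subst (2) swap) (simp only: sum.distrib)
  also have "Re \<dots> \<ge> 0"
    using assms unfolding square by (auto simp: psd_iff_sesq_form intro!: sum_nonneg)
  finally show ?thesis
    by simp
qed

lemma hermitian_diff: "hermitian X \<Longrightarrow> hermitian Y \<Longrightarrow> hermitian (X - Y)"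
  unfolding hermitian_def by (metis complex_cnj_diff vector_minus_component)

lemma partial_transpose_entry: "partial_transpose A $ (i, k) $ (j, l) = A $ (j, k) $ (i, l)"
  by (simp add: partial_transpose_def of_blocks_def block_def)

lemma kronecker_trace_entry:
  "kronecker (partial_trace2 (partial_transpose A)) (mat 1) $ (i, k) $ (j, l) =
    (if k = l then \<Sum>s\<in>UNIV. A $ (j, s) $ (i, s) else 0)"
  by (simp add: kronecker_def of_blocks_def partial_trace2_def trace_def block_def
      partial_transpose_entry mat_def)

lemma hadamard_identity_blocks_entry:
  "hadamard M (of_blocks (\<lambda>i j. mat 1)) $ (i, k) $ (j, l) =
    (if k = l then M $ (i, k) $ (j, l) else 0)"
  by (simp add: hadamard_def of_blocks_def mat_def)

theorem theorem3p2:
  fixes A J :: "('m::finite, 'n::finite) block_matrix"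
  assumes "psd A"
    and "J = of_blocks (\<lambda>i j. mat 1)"
  shows "kronecker (partial_trace2 (partial_transpose A)) (mat 1) \<succeq>
    - partial_transpose A + 2 *\<^sub>R hadamard (partial_transpose A) J"
proof -
  define X :: "('m, 'n) block_matrix" where
    "X = kronecker (partial_trace2 (partial_transpose A)) (mat 1)"
  define Y where "Y = - partial_transpose A + 2 *\<^sub>R hadamard (partial_transpose A) J"
  have herm: "cnj (A $ p $ q) = A $ q $ p" for p q
    using assms(1) by (metis psd_def hermitian_def)
  have hX: "hermitian X"
    by (auto simp: hermitian_def X_def kronecker_trace_entry herm)
  have hY: "hermitian Y"
    by (auto simp: hermitian_def Y_def assms(2) hadamard_identity_blocks_entry
        partial_transpose_entry herm)
  have entry: "(X - Y) $ (i, k) $ (j, l) =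
      (if k = l then \<Sum>s\<in>UNIV - {k}. A $ (j, s) $ (i, s) else A $ (j, k) $ (i, l))" for i j k l
    by (simp add: X_def Y_def assms(2) kronecker_trace_entry hadamard_identity_blocks_entry
        partial_transpose_entry sum_diff1 scaleR_conv_of_real)
  have "0 \<le> Re (sesq_form (X - Y) x x)" for x
  proof -
    define u where "u k l = slot k (\<lambda>i. cnj (x $ (i, l)))" for k l :: 'n
    define N where "N k l = (\<Sum>i\<in>UNIV. \<Sum>j\<in>UNIV.
      cnj (x $ (i, k)) * (X - Y) $ (i, k) $ (j, l) * x $ (j, l))" for k l
    \<comment> \<open>Conjugating the slices reverses the roles of \<open>i\<close> and \<open>j\<close>, which undoes the transposition
      of the blocks.\<close>
    have u_form: "sesq_form A (u k l) (u k' l') =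
        (\<Sum>i\<in>UNIV. \<Sum>j\<in>UNIV. cnj (x $ (i, l')) * A $ (j, k) $ (i, k') * x $ (j, l))" for k l k' l'
      unfolding u_def sesq_form_slot
      by (subst sum.swap) (simp add: mult_ac)
    have N_off: "N k l = sesq_form A (u k l) (u l k)" if "k \<noteq> l" for k l
      using that by (simp add: N_def entry u_form del: vector_minus_component)
    have N_diag: "N k k = (\<Sum>l\<in>UNIV - {k}. sesq_form A (u l k) (u l k))" for k
    proof -
      have "N k k = (\<Sum>i\<in>UNIV. \<Sum>j\<in>UNIV. \<Sum>l\<in>UNIV - {k}.
          cnj (x $ (i, k)) * A $ (j, l) $ (i, l) * x $ (j, k))"
        by (simp add: N_def entry sum_distrib_left sum_distrib_right del: vector_minus_component)
      also have "\<dots> = (\<Sum>i\<in>UNIV. \<Sum>l\<in>UNIV - {k}. \<Sum>j\<in>UNIV.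
          cnj (x $ (i, k)) * A $ (j, l) $ (i, l) * x $ (j, k))"
        by (intro sum.cong refl sum.swap)
      also have "\<dots> = (\<Sum>l\<in>UNIV - {k}. sesq_form A (u l k) (u l k))"
        unfolding u_form by (rule sum.swap)
      finally show ?thesis .
    qed
    have "sesq_form (X - Y) x x = (\<Sum>k\<in>UNIV. \<Sum>l\<in>UNIV. N k l)"
      unfolding N_def by (rule sesq_form_by_slots)
    also have "\<dots> = (\<Sum>k\<in>UNIV. N k k + (\<Sum>l\<in>UNIV - {k}. N k l))"
      by (intro sum.cong refl sum.remove) auto
    also have "\<dots> = (\<Sum>k\<in>UNIV. \<Sum>l\<in>UNIV - {k}.
        sesq_form A (u l k) (u l k) + sesq_form A (u k l) (u l k))"
      by (simp add: N_diag N_off sum.distrib)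
    finally show ?thesis
      using sum_sesq_form_symmetrized_nonneg[OF assms(1), of u] by simp
  qed
  then have "psd (X - Y)"
    using hermitian_diff[OF hX hY] by (simp add: psd_iff_sesq_form)
  then show ?thesis
    using hX hY unfolding loewner_ge_def X_def Y_def by blast
qed

end
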